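(* Let $\Sigma$ be a connected and unbalanced signed graph. Let $X$ be a nonempty vertex subset of $\Sigma$ such that $\Sigma[X]$ is connected. (a) There exists a switching $\nu$ on $X$ such that $U:=\delta X^\nu$ is a uni-cut of $\Sigma$. Moreover, $\Sigma[X]\setminus U$ is connected. (b) With $\nu$ as in (a), if $\mu$ is a switching on $X$ such that $\delta X^\nu=\delta X^\mu$, then $\mu=\nu$ on $X$ or $\mu=-\nu$ on $X$; that is, $\nu$ is unique up to a sign on $X$.
   Context: A graph $(V,E)$ has finite vertex set $V$ and finite edge set $E$ (multiple edges allowed); each edge has two ends, each end is attached to one vertex or to none, and at least one end is attached to a vertex. A loop has both ends at the same vertex, a link has its ends at two distinct vertices, an outer-edge has exactly one end attached to a vertex. A signed graph $\Sigma=(V,E,\sigma)$ is a graph with a sign function $\sigma:E\to\{1,-1\}$. A circle is a connected 2-regular signed (sub)graph without outer-edges (a loop with its vertex is a circle); its sign is the product of its edge signs. A signed graph is balanced if it has no outer-edges and all its circles are positive; otherwise it is unbalanced. $\Sigma\setminus S$ denotes deletion of the edges in $S$ (vertices are kept). For a nonempty $X\subseteq V$: $X^c=V\setminus X$; $O_X$ is the set of outer-edges with endpoint in $X$; $[X,X^c]$ is the set of links between $X$ and $X^c$; $\Sigma[X]$ is the signed subgraph with vertex set $X$ and all loops and links of $\Sigma$ having all endpoints in $X$. A switching on $X$ is a function $\nu:V\to\{1,-1\}$ with $\nu(v)=1$ for $v\in X^c$. The switched signed graph $\Sigma^\nu$ has the same vertices and edges and sign $\sigma^\nu(e)=\nu(u)\sigma(e)\nu(v)$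 for a loop or link $e=uv$, and $\sigma^\nu(e)=\nu(u)\sigma(e)$ for an outer-edge at $u$. Put $$\delta X^\nu:=[X,X^c]\cup E_X\cup O_X,$$ where $E_X$ is the set of edges $e$ of $\Sigma[X]$ with $\sigma^\nu(e)=-1$. A cut of $\Sigma$ is a nonempty edge subset $U$ of the form $U=\delta X^\nu$, with $X$ nonempty and $\nu$ a switching on $X$, such that $\Sigma[X]\setminus U$ is balanced, the edges of $\Sigma[X]$ in $U$ are negative in $\Sigma^\nu$, the edges of $\Sigma[X]$ not in $U$ are positive in $\Sigma^\nu$, and $(\Sigma[X]\setminus U)\cup e$ is unbalanced for each edge $e$ of $\Sigma[X]$ belonging to $U$. The cut is a uni-cut if $\Sigma[X]$ is connected. *)

theory Defs
  imports Main "HOL-Library.Multiset"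
begin

text \<open>
  The multiset \<open>ends G e\<close> holds the vertices to which the two ends of the edge \<open>e\<close> are attached:
  \<open>{#v, v#}\<close> for a loop at \<open>v\<close>, \<open>{#u, v#}\<close> with \<open>u \<noteq> v\<close> for a link, and \<open>{#v#}\<close> for an
  outer-edge, whose other end is attached to no vertex.  The values of \<open>ends\<close> and \<open>esign\<close> outside
  \<open>edges G\<close> are irrelevant.
\<close>

record ('v, 'e) sgraph =
  verts :: "'v set"
  edges :: "'e set"
  ends  :: "'e \<Rightarrow> 'v multiset"
  esign :: "'e \<Rightarrow> int"

locale signed_graph =
  fixes G :: "('v, 'e) sgraph"
  assumes finite_verts: "finite (verts G)"
    and finite_edges: "finite (edges G)"
    and ends_in_verts: "e \<in> edges G \<Longrightarrow> set_mset (ends G e) \<subseteq> verts G"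
    and size_ends: "e \<in> edges G \<Longrightarrow> size (ends G e) = 1 \<or> size (ends G e) = 2"
    and esign_values: "e \<in> edges G \<Longrightarrow> esign G e = 1 \<or> esign G e = -1"

definition loops :: "('v, 'e) sgraph \<Rightarrow> 'e set" where
  "loops G = {e \<in> edges G. \<exists>v. ends G e = {#v, v#}}"

definition links :: "('v, 'e) sgraph \<Rightarrow> 'e set" where
  "links G = {e \<in> edges G. \<exists>u v. u \<noteq> v \<and> ends G e = {#u, v#}}"

definition outer_edges :: "('v, 'e) sgraph \<Rightarrow> 'e set" where
  "outer_edges G = {e \<in> edges G. \<exists>v. ends G e = {#v#}}"

definition adj_rel :: "('v, 'e) sgraph \<Rightarrow> ('v \<times> 'v) set" where
  "adj_rel G = {(u, v). \<exists>e \<in> edges G. ends G e = {#u, v#}}"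

definition graph_connected :: "('v, 'e) sgraph \<Rightarrow> bool" where
  "graph_connected G \<longleftrightarrow>
     verts G \<noteq> {} \<and> (\<forall>u \<in> verts G. \<forall>v \<in> verts G. (u, v) \<in> (adj_rel G)\<^sup>*)"

text \<open>A loop contributes 2 to the degree of its vertex.\<close>

definition degree :: "('v, 'e) sgraph \<Rightarrow> 'v \<Rightarrow> nat" where
  "degree G v = (\<Sum>e \<in> edges G. count (ends G e) v)"

definition signed_subgraph :: "('v, 'e) sgraph \<Rightarrow> ('v, 'e) sgraph \<Rightarrow> bool" where
  "signed_subgraph H G \<longleftrightarrow>
     signed_graph H \<and> verts H \<subseteq> verts G \<and> edges H \<subseteq> edges G \<and>
     (\<forall>e \<in> edges H. ends H e = ends G e \<and> esign H e = esign G e)"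

definition circle :: "('v, 'e) sgraph \<Rightarrow> bool" where
  "circle C \<longleftrightarrow>
     signed_graph C \<and> graph_connected C \<and> outer_edges C = {} \<and> (\<forall>v \<in> verts C. degree C v = 2)"

definition circle_sign :: "('v, 'e) sgraph \<Rightarrow> int" where
  "circle_sign C = (\<Prod>e \<in> edges C. esign C e)"

definition balanced :: "('v, 'e) sgraph \<Rightarrow> bool" where
  "balanced G \<longleftrightarrow>
     outer_edges G = {} \<and> (\<forall>C. signed_subgraph C G \<and> circle C \<longrightarrow> circle_sign C = 1)"

definition delete_edges :: "('v, 'e) sgraph \<Rightarrow> 'e set \<Rightarrow> ('v, 'e) sgraph" where
  "delete_edges G S = G\<lparr>edges := edges G - S\<rparr>"

definition add_edge :: "('v, 'e) sgraph \<Rightarrow> 'e \<Rightarrow> ('v, 'e) sgraph" where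
  "add_edge G e = G\<lparr>edges := insert e (edges G)\<rparr>"

text \<open>The induced signed graph \<open>G[X]\<close> contains no outer-edges, not even those attached to \<open>X\<close>.\<close>

definition induced :: "('v, 'e) sgraph \<Rightarrow> 'v set \<Rightarrow> ('v, 'e) sgraph" where
  "induced G X = G\<lparr>verts := X, edges := {e \<in> loops G \<union> links G. set_mset (ends G e) \<subseteq> X}\<rparr>"

definition outer_edges_at :: "('v, 'e) sgraph \<Rightarrow> 'v set \<Rightarrow> 'e set" where
  "outer_edges_at G X = {e \<in> outer_edges G. set_mset (ends G e) \<subseteq> X}"

definition boundary_links :: "('v, 'e) sgraph \<Rightarrow> 'v set \<Rightarrow> 'e set" where
  "boundary_links G X = {e \<in> links G. \<exists>u \<in> X. \<exists>v \<in> verts G - X. ends G e = {#u, v#}}"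

definition switching_on :: "('v, 'e) sgraph \<Rightarrow> 'v set \<Rightarrow> ('v \<Rightarrow> int) \<Rightarrow> bool" where
  "switching_on G X \<nu> \<longleftrightarrow>
     (\<forall>v \<in> verts G. \<nu> v = 1 \<or> \<nu> v = -1) \<and> (\<forall>v \<in> verts G - X. \<nu> v = 1)"

text \<open>
  The product over the ends is \<open>\<nu> u * \<nu> v\<close> for a loop or link with ends at \<open>u\<close> and \<open>v\<close>, and
  \<open>\<nu> u\<close> for an outer-edge at \<open>u\<close>.
\<close>

definition switch :: "('v, 'e) sgraph \<Rightarrow> ('v \<Rightarrow> int) \<Rightarrow> ('v, 'e) sgraph" where
  "switch G \<nu> = G\<lparr>esign := (\<lambda>e. esign G e * (\<Prod>v \<in># ends G e. \<nu> v))\<rparr>"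

definition delta :: "('v, 'e) sgraph \<Rightarrow> 'v set \<Rightarrow> ('v \<Rightarrow> int) \<Rightarrow> 'e set" where
  "delta G X \<nu> =
     boundary_links G X \<union> {e \<in> edges (induced G X). esign (switch G \<nu>) e = -1}
       \<union> outer_edges_at G X"

text \<open>
  Being a cut is recorded together with the pair \<open>(X, \<nu>)\<close> that presents it.  The same edge set may
  equal \<open>delta G Y \<mu>\<close> for a different \<open>Y\<close>, and the connectedness of \<open>G[X]\<close> required of a uni-cut
  refers to the presenting vertex set.
\<close>

definition cut_by :: "('v, 'e) sgraph \<Rightarrow> 'v set \<Rightarrow> ('v \<Rightarrow> int) \<Rightarrow> 'e set \<Rightarrow> bool" where
  "cut_by G X \<nu> U \<longleftrightarrow>
     X \<noteq> {} \<and> X \<subseteq> verts G \<and> switching_on G X \<nu> \<and>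
     U \<noteq> {} \<and> U = delta G X \<nu> \<and>
     balanced (delete_edges (induced G X) U) \<and>
     (\<forall>e \<in> edges (induced G X) \<inter> U. esign (switch G \<nu>) e = -1) \<and>
     (\<forall>e \<in> edges (induced G X) - U. esign (switch G \<nu>) e = 1) \<and>
     (\<forall>e \<in> edges (induced G X) \<inter> U.
        \<not> balanced (add_edge (delete_edges (induced G X) U) e))"

definition uni_cut_by :: "('v, 'e) sgraph \<Rightarrow> 'v set \<Rightarrow> ('v \<Rightarrow> int) \<Rightarrow> 'e set \<Rightarrow> bool" where
  "uni_cut_by G X \<nu> U \<longleftrightarrow> cut_by G X \<nu> U \<and> graph_connected (induced G X)"

end

theory Submission imports Defs
begin

text \<open>
  Write \<open>H\<close> for \<open>\<Sigma>[X]\<close> and let \<open>\<kappa>\<close> be a \<open>\<plusminus>1\<close>-valued vertex function.  Switching by \<open>\<kappa>\<close> multiplies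
  the sign of an edge by the product of \<open>\<kappa>\<close> over its ends, and these products cancel around a circle
  because every vertex of the circle has degree 2 (\<open>circle_prod_ends\<close>).  Two uses of this fact carry
  the proof.  Firstly, circle signs may be computed after switching: if the edges of \<open>H\<close> in \<open>U\<close>
  are exactly the negative ones after switching, then \<open>H - U\<close> is balanced, and a circle of \<open>H\<close> with
  exactly one edge in \<open>U\<close> is negative.  Secondly, with \<open>\<kappa> = -1\<close> on one side of a vertex bipartition, it says that a circle
  cannot cross the bipartition in a single edge.

  Existence: choose a switching \<open>\<nu>\<close> on \<open>X\<close> that makes as few edges of \<open>H\<close> negative as possible.  If
  the positive edges did not connect \<open>X\<close>, negating \<open>\<nu>\<close> on one component of the positive part
  would turn some negative edges positive and no positive edge negative (\<open>separating_switching\<close>).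
  Hence the positive part is connected, and each negative edge closes a path of positive edges to a
  negative circle (\<open>path_closes_to_circle\<close>, \<open>negative_edge_unbalances\<close>), which is the minimality
  demanded of a cut.  The cut is nonempty: if \<open>X\<close> is not the whole vertex set, connectedness of \<open>\<Sigma>\<close>
  gives a link leaving \<open>X\<close>; otherwise an empty cut would make \<open>\<Sigma>\<close> balanced.

  Connectedness of \<open>H - U\<close> holds for every uni-cut \<open>U\<close>: if it failed, some edge \<open>e\<close> of \<open>U\<close> would
  be the only edge of \<open>(H - U) \<union> e\<close> between two sides of a bipartition, so no circle could use \<open>e\<close>
  and adding \<open>e\<close> would not destroy balance.

  Uniqueness: if \<open>\<nu>\<close> and \<open>\<mu>\<close> yield the same set, they yield the same switched signs on \<open>H\<close>, so
  \<open>\<nu> \<mu>\<close> takes equal values at adjacent vertices and is constant on the connected graph \<open>H\<close>.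
\<close>

section \<open>Switching and circles\<close>

lemma prod_mset_eq_prod_power_count:
  fixes f :: "'a \<Rightarrow> 'b::comm_monoid_mult"
  assumes "finite A" "set_mset M \<subseteq> A"
  shows "(\<Prod>v\<in>#M. f v) = (\<Prod>v\<in>A. f v ^ count M v)"
  using assms(2)
proof (induction M)
  case empty
  then show ?case by simp
next
  case (add x M)
  have "(\<Prod>v\<in>A. f v ^ count (add_mset x M) v)
      = (\<Prod>v\<in>A. (if v = x then f v else 1) * f v ^ count M v)"
    by (rule prod.cong) auto
  also have "\<dots> = f x * (\<Prod>v\<in>A. f v ^ count M v)"
    using assms(1) add.prems by (simp add: prod.distrib)
  finally show ?case using add by simp
qed

lemma prod_mset_sign:
  fixes \<kappa> :: "'a \<Rightarrow> int"
  assumes "\<And>v. v \<in># M \<Longrightarrow> \<kappa> v = 1 \<or> \<kappa> v = -1"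
  shows "(\<Prod>v\<in>#M. \<kappa> v) = 1 \<or> (\<Prod>v\<in>#M. \<kappa> v) = -1"
  using assms
proof (induction M)
  case (add x M)
  then have "(\<Prod>v\<in>#M. \<kappa> v) = 1 \<or> (\<Prod>v\<in>#M. \<kappa> v) = -1" by simp
  moreover have "\<kappa> x = 1 \<or> \<kappa> x = -1" using add.prems[of x] by simp
  ultimately show ?case by auto
qed simp

text \<open>
  Collecting the factors vertex by vertex, \<open>\<kappa> v\<close> occurs as often as the degree of \<open>v\<close>, that is twice.
\<close>

lemma circle_prod_ends:
  fixes \<kappa> :: "'v \<Rightarrow> int"
  assumes "circle C" and \<kappa>: "\<And>v. v \<in> verts C \<Longrightarrow> \<kappa> v = 1 \<or> \<kappa> v = -1"
  shows "(\<Prod>e\<in>edges C. \<Prod>v\<in>#ends C e. \<kappa> v) = 1"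
proof -
  interpret signed_graph C using assms(1) by (simp add: circle_def)
  have "(\<Prod>e\<in>edges C. \<Prod>v\<in>#ends C e. \<kappa> v)
      = (\<Prod>e\<in>edges C. \<Prod>v\<in>verts C. \<kappa> v ^ count (ends C e) v)"
    by (rule prod.cong) (auto intro!: prod_mset_eq_prod_power_count finite_verts dest: ends_in_verts)
  also have "\<dots> = (\<Prod>v\<in>verts C. \<Prod>e\<in>edges C. \<kappa> v ^ count (ends C e) v)"
    by (rule prod.swap)
  also have "\<dots> = (\<Prod>v\<in>verts C. \<kappa> v ^ degree C v)"
    by (simp add: degree_def power_sum)
  also have "\<dots> = 1"
    using assms(1) by (intro prod.neutral) (auto simp: circle_def dest: \<kappa>)
  finally show ?thesis .
qed

lemma circle_sign_switch:
  assumes "circle C" and "\<And>v. v \<in> verts C \<Longrightarrow> \<nu> v = 1 \<or> \<nu> v = -1"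
  shows "circle_sign (switch C \<nu>) = circle_sign C"
  using circle_prod_ends[OF assms] by (simp add: circle_sign_def switch_def prod.distrib)

text \<open>The easy direction of Harary's balance theorem.\<close>

lemma balanced_if_switched_positive:
  assumes "outer_edges G = {}"
    and "\<And>v. v \<in> verts G \<Longrightarrow> \<nu> v = 1 \<or> \<nu> v = -1"
    and "\<And>e. e \<in> edges G \<Longrightarrow> esign (switch G \<nu>) e = 1"
  shows "balanced G"
  unfolding balanced_def
proof (intro conjI allI impI)
  fix C assume C: "signed_subgraph C G \<and> circle C"
  have "circle_sign (switch C \<nu>) = circle_sign C"
    using C assms(2) by (intro circle_sign_switch) (auto simp: signed_subgraph_def)
  moreover have "circle_sign (switch C \<nu>) = 1"
    unfolding circle_sign_def
    using C assms(3) by (intro prod.neutral) (auto simp: switch_def signed_subgraph_def subset_iff)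
  ultimately show "circle_sign C = 1" by simp
qed (fact assms(1))

section \<open>Connectedness\<close>

lemma adj_rel_sym: "(u, v) \<in> adj_rel G \<Longrightarrow> (v, u) \<in> adj_rel G"
  by (auto simp: adj_rel_def add_mset_commute)

lemma rtrancl_leaves_set:
  assumes "(u, w) \<in> R\<^sup>*" "u \<in> A" "w \<notin> A"
  obtains a b where "(a, b) \<in> R" "a \<in> A" "b \<notin> A"
  using assms by (induction rule: rtrancl_induct) auto

text \<open>
  The function \<open>\<kappa>\<close> is \<open>-1\<close> exactly on one component of the graph without \<open>S\<close>; an edge with product
  \<open>-1\<close> leaves that component.
\<close>

lemma separating_switching:
  assumes "graph_connected H" and "\<not> graph_connected (delete_edges H S)"
    and two_ends: "\<And>f. f \<in> edges H \<Longrightarrow> \<exists>p q. ends H f = {#p, q#}"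
  obtains \<kappa> :: "'v \<Rightarrow> int" and e where "\<And>v. \<kappa> v = 1 \<or> \<kappa> v = -1"
    and "\<And>f. f \<in> edges H - S \<Longrightarrow> (\<Prod>v\<in>#ends H f. \<kappa> v) = 1"
    and "e \<in> edges H \<inter> S" and "(\<Prod>v\<in>#ends H e. \<kappa> v) = -1"
proof -
  let ?R = "adj_rel (delete_edges H S)"
  obtain a b where ab: "a \<in> verts H" "b \<in> verts H" "(a, b) \<notin> ?R\<^sup>*"
    using assms(1,2) by (auto simp: graph_connected_def delete_edges_def)
  define A where "A = {x. (a, x) \<in> ?R\<^sup>*}"
  define \<kappa> :: "'v \<Rightarrow> int" where "\<kappa> = (\<lambda>v. if v \<in> A then -1 else 1)"
  have closed: "q \<in> A" if "p \<in> A" "(p, q) \<in> ?R" for p q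
    using that by (auto simp: A_def intro: rtrancl_into_rtrancl)
  have pos: "(\<Prod>v\<in>#ends H f. \<kappa> v) = 1" if f: "f \<in> edges H - S" for f
  proof -
    obtain p q where pq: "ends H f = {#p, q#}" using two_ends f by blast
    then have "(p, q) \<in> ?R" using f by (auto simp: adj_rel_def delete_edges_def)
    then have "p \<in> A \<longleftrightarrow> q \<in> A" using closed adj_rel_sym by metis
    then show ?thesis by (auto simp: pq \<kappa>_def)
  qed
  have "(a, b) \<in> (adj_rel H)\<^sup>*" "a \<in> A" "b \<notin> A"
    using assms(1) ab by (auto simp: graph_connected_def A_def)
  then obtain p q where "(p, q) \<in> adj_rel H" "p \<in> A" "q \<notin> A"
    by (rule rtrancl_leaves_set)
  then obtain e where e: "e \<in> edges H" "ends H e = {#p, q#}" "p \<in> A" "q \<notin> A"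
    by (auto simp: adj_rel_def)
  then have neg: "(\<Prod>v\<in>#ends H e. \<kappa> v) = -1" by (simp add: \<kappa>_def)
  with pos[of e] e have "e \<in> S" by auto
  with e neg pos show ?thesis by (intro that[of \<kappa> e]) (auto simp: \<kappa>_def)
qed

text \<open>
  If \<open>H - S\<close> were disconnected, take \<open>\<kappa>\<close> and \<open>e\<close> from \<open>separating_switching\<close>.  The products of \<open>\<kappa>\<close>
  multiply to 1 around a circle, but among the edges of \<open>(H - S) \<union> e\<close> only \<open>e\<close> contributes \<open>-1\<close>; so
  the negative circle of this graph would avoid \<open>e\<close> and lie in the balanced graph \<open>H - S\<close>.
\<close>

lemma connected_if_edges_unbalance:
  assumes "graph_connected H"
    and "\<And>f. f \<in> edges H \<Longrightarrow> \<exists>p q. ends H f = {#p, q#}"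
    and bal: "balanced (delete_edges H S)"
    and unbal: "\<And>e. e \<in> edges H \<inter> S \<Longrightarrow> \<not> balanced (add_edge (delete_edges H S) e)"
  shows "graph_connected (delete_edges H S)"
proof (rule ccontr)
  assume "\<not> graph_connected (delete_edges H S)"
  from separating_switching[OF assms(1) this assms(2)]
  obtain \<kappa> :: "'a \<Rightarrow> int" and e where \<kappa>: "\<And>v. \<kappa> v = 1 \<or> \<kappa> v = -1"
    and pos: "\<And>f. f \<in> edges H - S \<Longrightarrow> (\<Prod>v\<in>#ends H f. \<kappa> v) = 1"
    and e: "e \<in> edges H \<inter> S" and neg: "(\<Prod>v\<in>#ends H e. \<kappa> v) = -1"
    by blast
  have "outer_edges (add_edge (delete_edges H S) e) = {}"
    using assms(2) e by (fastforce simp: outer_edges_def add_edge_def delete_edges_def)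
  with unbal[OF e] obtain C where C: "signed_subgraph C (add_edge (delete_edges H S) e)"
      "circle C" "circle_sign C \<noteq> 1"
    by (auto simp: balanced_def)
  have eC: "e \<in> edges C"
  proof (rule ccontr)
    assume "e \<notin> edges C"
    with C(1) have "signed_subgraph C (delete_edges H S)"
      by (auto simp: signed_subgraph_def add_edge_def delete_edges_def)
    with bal C show False by (auto simp: balanced_def)
  qed
  have fin: "finite (edges C)"
    using C(1) by (simp add: signed_subgraph_def signed_graph.finite_edges)
  have ends: "ends C f = ends H f" if "f \<in> edges C" for f
    using C(1) that by (auto simp: signed_subgraph_def add_edge_def delete_edges_def)
  have "(\<Prod>f\<in>edges C. \<Prod>v\<in>#ends C f. \<kappa> v)
      = (\<Prod>v\<in>#ends C e. \<kappa> v) * (\<Prod>f\<in>edges C - {e}. \<Prod>v\<in>#ends C f. \<kappa> v)"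
    using fin eC by (rule prod.remove)
  also have "(\<Prod>f\<in>edges C - {e}. \<Prod>v\<in>#ends C f. \<kappa> v) = 1"
  proof (rule prod.neutral, rule ballI)
    fix f assume f: "f \<in> edges C - {e}"
    then have "f \<in> edges H - S"
      using C(1) by (auto simp: signed_subgraph_def add_edge_def delete_edges_def)
    with pos ends f show "(\<Prod>v\<in>#ends C f. \<kappa> v) = 1" by simp
  qed
  also have "(\<Prod>v\<in>#ends C e. \<kappa> v) = -1" using ends eC neg by simp
  finally show False using circle_prod_ends[OF C(2), of \<kappa>] \<kappa> by simp
qed

section \<open>Paths and circles\<close>

text \<open>
  \<open>edge_path G u S F v\<close>: the vertices \<open>S\<close> and edges \<open>F\<close> form a path from \<open>u\<close> to \<open>v\<close>.  Growing the path
  at one end by a new vertex makes distinctness of its vertices part of the definition.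
\<close>

inductive edge_path :: "('v, 'e) sgraph \<Rightarrow> 'v \<Rightarrow> 'v set \<Rightarrow> 'e set \<Rightarrow> 'v \<Rightarrow> bool" for G u where
  trivial: "edge_path G u {u} {} u"
| extend: "edge_path G u S F v \<Longrightarrow> f \<in> edges G \<Longrightarrow> ends G f = {#v, w#} \<Longrightarrow> w \<notin> S \<Longrightarrow>
    edge_path G u (insert w S) (insert f F) w"

lemma edge_path_prefix:
  assumes "edge_path G u S F v" "w \<in> S"
  shows "\<exists>S' F'. edge_path G u S' F' w"
  using assms by (induction) (auto intro: edge_path.intros)

text \<open>If the next vertex of a walk already lies on the path, an initial piece of the path is taken.\<close>

lemma edge_path_if_reachable:
  assumes "(u, v) \<in> (adj_rel G)\<^sup>*"
  shows "\<exists>S F. edge_path G u S F v"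
  using assms
proof (induction rule: rtrancl_induct)
  case base
  show ?case using edge_path.trivial by fast
next
  case (step v w)
  then obtain S F f where *: "edge_path G u S F v" "f \<in> edges G" "ends G f = {#v, w#}"
    by (auto simp: adj_rel_def)
  show ?case
  proof (cases "w \<in> S")
    case True
    with * show ?thesis by (auto intro: edge_path_prefix)
  next
    case False
    with * show ?thesis by (blast intro: edge_path.extend)
  qed
qed

lemma edge_path_basic:
  assumes "edge_path G u S F v"
  shows "u \<in> S" "v \<in> S" "finite S" "finite F" "F \<subseteq> edges G"
    "\<And>f. f \<in> F \<Longrightarrow> set_mset (ends G f) \<subseteq> S"
    "\<And>f. f \<in> F \<Longrightarrow> size (ends G f) = 2"
  using assms by (induction) auto

lemma edge_path_verts:
  assumes "edge_path G u S F v" "u \<in> verts G"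
    and "\<And>f. f \<in> edges G \<Longrightarrow> set_mset (ends G f) \<subseteq> verts G"
  shows "S \<subseteq> verts G"
  using assms(1)
proof induction
  case (extend S F v f w)
  with assms(3)[of f] show ?case by auto
qed (use assms(2) in simp)

text \<open>
  The two correction terms are the ends of an edge that closes the path; counting them makes the
  statement uniform, including the trivial path, which is closed by a loop.
\<close>

lemma edge_path_degree:
  assumes "edge_path G u S F v"
  shows "(\<Sum>f\<in>F. count (ends G f) x) + count {#u, v#} x = (if x \<in> S then 2 else 0)"
  using assms
proof induction
  case trivial
  show ?case by auto
next
  case (extend S F v f w)
  note basic = edge_path_basic[OF extend.hyps(1)]
  have "f \<notin> F" using basic(6)[of f] extend.hyps by auto
  then have "(\<Sum>f\<in>insert f F. count (ends G f) x)
      = count {#v, w#} x + (\<Sum>f\<in>F. count (ends G f) x)"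
    using basic(4) extend.hyps by simp
  with extend.IH extend.hyps basic(1,2) show ?case by (auto split: if_splits)
qed

lemma edge_path_connects:
  assumes "edge_path G u S F v" "x \<in> S" "F \<subseteq> edges C" "\<And>f. f \<in> F \<Longrightarrow> ends C f = ends G f"
  shows "(u, x) \<in> (adj_rel C)\<^sup>*"
  using assms
proof (induction arbitrary: x)
  case trivial
  then show ?case by simp
next
  case (extend S F v f w)
  have IH: "(u, y) \<in> (adj_rel C)\<^sup>*" if "y \<in> S" for y
    using extend.IH[OF that] extend.prems by auto
  have "f \<in> edges C" "ends C f = {#v, w#}" using extend.hyps(3) extend.prems by auto
  then have "(v, w) \<in> adj_rel C" by (auto simp: adj_rel_def)
  moreover have "(u, v) \<in> (adj_rel C)\<^sup>*" using IH edge_path_basic(2)[OF extend.hyps(1)] .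
  ultimately show ?case using extend.prems(1) IH by (auto intro: rtrancl_into_rtrancl)
qed

lemma path_closes_to_circle:
  assumes "signed_graph G" and path: "edge_path G u S F v"
    and "u \<in> verts G" "e \<in> edges G" "e \<notin> F" and e: "ends G e = {#u, v#}"
  defines "C \<equiv> G\<lparr>verts := S, edges := insert e F\<rparr>"
  shows "signed_subgraph C G" "circle C"
proof -
  interpret signed_graph G by fact
  note basic = edge_path_basic[OF path]
  have S: "S \<subseteq> verts G" using path assms(3) ends_in_verts by (rule edge_path_verts)
  have sg: "signed_graph C"
  proof
    have edges: "edges C \<subseteq> edges G" using basic(5) assms(4) by (auto simp: C_def)
    then show "finite (edges C)" using finite_edges by (rule finite_subset)
    show "finite (verts C)" using basic(3) by (simp add: C_def)
    fix f assume f: "f \<in> edges C"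
    then show "set_mset (ends C f) \<subseteq> verts C" using basic(1,2) basic(6)[of f] e
      by (auto simp: C_def)
    show "size (ends C f) = 1 \<or> size (ends C f) = 2" using f basic(7)[of f] e
      by (auto simp: C_def)
    show "esign C f = 1 \<or> esign C f = -1" using esign_values[of f] f edges
      by (auto simp: C_def)
  qed
  then show "signed_subgraph C G"
    using S basic assms(4) by (auto simp: signed_subgraph_def C_def)
  have reach: "(u, x) \<in> (adj_rel C)\<^sup>*" if "x \<in> S" for x
    using path that by (rule edge_path_connects) (auto simp: C_def)
  have "sym ((adj_rel C)\<^sup>*)"
    by (rule sym_rtrancl, rule symI, rule adj_rel_sym)
  then have "(x, y) \<in> (adj_rel C)\<^sup>*" if "x \<in> S" "y \<in> S" for x y
    using reach that by (blast dest: symD intro: rtrancl_trans)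
  then have "graph_connected C"
    using basic(1) by (auto simp: graph_connected_def C_def)
  moreover have "outer_edges C = {}"
    using basic(7) e by (fastforce simp: outer_edges_def C_def)
  moreover have "degree C x = 2" if "x \<in> verts C" for x
    using edge_path_degree[OF path, of x] that basic(4) assms(5)
    by (simp add: degree_def C_def e)
  ultimately show "circle C" using sg unfolding circle_def by blast
qed

text \<open>
  After switching, the circle that \<open>e\<close> closes with a path of positive edges has \<open>e\<close> as its only
  negative edge.
\<close>

lemma negative_edge_unbalances:
  assumes sg: "signed_graph H" and conn: "graph_connected (delete_edges H S)"
    and \<nu>: "\<And>v. v \<in> verts H \<Longrightarrow> \<nu> v = 1 \<or> \<nu> v = -1"
    and pos: "\<And>f. f \<in> edges H - S \<Longrightarrow> esign (switch H \<nu>) f = 1"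
    and e: "e \<in> edges H \<inter> S" "ends H e = {#u, v#}" "esign (switch H \<nu>) e = -1"
  shows "\<not> balanced (add_edge (delete_edges H S) e)"
proof
  let ?G = "add_edge (delete_edges H S) e"
  assume bal: "balanced ?G"
  interpret signed_graph H by fact
  have uv: "u \<in> verts H" "v \<in> verts H" using ends_in_verts[of e] e by auto
  then have "(u, v) \<in> (adj_rel (delete_edges H S))\<^sup>*"
    using conn by (simp add: graph_connected_def delete_edges_def)
  then obtain T F where path: "edge_path (delete_edges H S) u T F v"
    using edge_path_if_reachable by metis
  then have F: "F \<subseteq> edges H - S" "finite F"
    using edge_path_basic by (fastforce simp: delete_edges_def)+
  have path': "edge_path ?G u T F v"
    using path by induction (auto intro!: edge_path.intros simp: add_edge_def delete_edges_def)
  have sg': "signed_graph ?G"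
    by unfold_locales (use finite_verts finite_edges ends_in_verts size_ends esign_values e
        in \<open>auto simp: add_edge_def delete_edges_def\<close>)
  define C where "C = ?G\<lparr>verts := T, edges := insert e F\<rparr>"
  have C: "signed_subgraph C ?G" "circle C"
    using path_closes_to_circle[OF sg' path'] F(1) e uv
    by (auto simp: C_def add_edge_def delete_edges_def)
  have "circle_sign (switch C \<nu>) = circle_sign C"
    using C \<nu> by (intro circle_sign_switch)
      (auto simp: signed_subgraph_def add_edge_def delete_edges_def)
  also have "\<dots> = 1" using bal C by (simp add: balanced_def)
  finally have "circle_sign (switch C \<nu>) = 1" .
  moreover have "circle_sign (switch C \<nu>)
      = esign (switch H \<nu>) e * (\<Prod>f\<in>F. esign (switch H \<nu>) f)"
    using F e by (subst prod.insert[symmetric])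
      (auto simp: circle_sign_def switch_def C_def add_edge_def delete_edges_def)
  moreover have "(\<Prod>f\<in>F. esign (switch H \<nu>) f) = 1"
    using F pos by (intro prod.neutral) auto
  ultimately show False using e by simp
qed

section \<open>Induced subgraphs and cuts\<close>

lemma verts_induced [simp]: "verts (induced G X) = X"
  by (simp add: induced_def)

lemma ends_induced [simp]: "ends (induced G X) = ends G"
  by (simp add: induced_def)

lemma two_ends_induced: "f \<in> edges (induced G X) \<Longrightarrow> \<exists>p q. ends (induced G X) f = {#p, q#}"
  by (auto simp: induced_def loops_def links_def)

lemma esign_switch_induced [simp]: "esign (switch (induced G X) \<nu>) = esign (switch G \<nu>)"
  by (simp add: induced_def switch_def)

lemma esign_switch: "esign (switch G \<nu>) e = esign G e * (\<Prod>v\<in>#ends G e. \<nu> v)"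
  by (simp add: switch_def)

lemma edges_induced_subset: "edges (induced G X) \<subseteq> edges G"
  by (auto simp: induced_def loops_def links_def)

lemma ends_induced_edge:
  assumes "e \<in> edges (induced G X)"
  obtains p q where "ends G e = {#p, q#}" "p \<in> X" "q \<in> X"
  using assms by (auto simp: induced_def loops_def links_def)

context signed_graph
begin

lemma signed_graph_induced:
  assumes "X \<subseteq> verts G"
  shows "signed_graph (induced G X)"
proof
  show "finite (verts (induced G X))"
    using assms finite_verts by (auto intro: finite_subset)
  show "finite (edges (induced G X))"
    using edges_induced_subset finite_edges by (rule finite_subset)
  fix e assume e: "e \<in> edges (induced G X)"
  then show "set_mset (ends (induced G X) e) \<subseteq> verts (induced G X)"
    by (auto elim: ends_induced_edge)
  show "size (ends (induced G X) e) = 1 \<or> size (ends (induced G X) e) = 2"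
    using e by (auto elim: ends_induced_edge)
  show "esign (induced G X) e = 1 \<or> esign (induced G X) e = -1"
    using e edges_induced_subset[of G X] esign_values by (auto simp: induced_def)
qed

lemma edges_subset_induced_verts:
  assumes "outer_edges G = {}"
  shows "edges G \<subseteq> edges (induced G (verts G))"
proof
  fix e assume e: "e \<in> edges G"
  have "size (ends G e) \<noteq> 1"
  proof
    assume "size (ends G e) = 1"
    then obtain v where "ends G e = {#v#}" by (metis size_1_singleton_mset)
    with e assms show False by (auto simp: outer_edges_def)
  qed
  with size_ends[OF e] have "size (ends G e) = 2" by simp
  then obtain p q where "ends G e = {#p, q#}"
    using size_eq_Suc_imp_eq_union[of "ends G e" 1] size_1_singleton_mset by fastforce
  then show "e \<in> edges (induced G (verts G))"
    using e ends_in_verts[OF e] by (cases "p = q") (auto simp: induced_def loops_def links_def)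
qed

lemma switched_sign_values:
  assumes "switching_on G X \<nu>" "e \<in> edges G"
  shows "esign (switch G \<nu>) e = 1 \<or> esign (switch G \<nu>) e = -1"
proof -
  have "(\<Prod>v\<in>#ends G e. \<nu> v) = 1 \<or> (\<Prod>v\<in>#ends G e. \<nu> v) = -1"
    using assms ends_in_verts by (intro prod_mset_sign) (auto simp: switching_on_def)
  with esign_values[OF assms(2)] show ?thesis by (auto simp: esign_switch)
qed

lemma delta_inter_induced:
  "edges (induced G X) \<inter> delta G X \<nu> = {e \<in> edges (induced G X). esign (switch G \<nu>) e = -1}"
proof -
  have "e \<notin> boundary_links G X" "e \<notin> outer_edges_at G X" if e: "e \<in> edges (induced G X)" for e
    proof -
    obtain p q where pq: "ends G e = {#p, q#}" "p \<in> X" "q \<in> X"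
      by (rule ends_induced_edge[OF e])
    then show "e \<notin> outer_edges_at G X" by (simp add: outer_edges_at_def outer_edges_def)
    have "set_mset (ends G e) \<subseteq> X" using pq by simp
    then show "e \<notin> boundary_links G X" by (auto simp: boundary_links_def)
  qed
  then show ?thesis by (auto simp: delta_def)
qed

lemma switched_positive_outside_delta:
  assumes "switching_on G X \<nu>" "e \<in> edges (induced G X) - delta G X \<nu>"
  shows "esign (switch G \<nu>) e = 1"
  using assms switched_sign_values[of X \<nu> e] edges_induced_subset[of G X]
    delta_inter_induced[of X \<nu>] by blast

lemma balanced_outside_delta:
  assumes "switching_on G X \<nu>" "X \<subseteq> verts G"
  shows "balanced (delete_edges (induced G X) (delta G X \<nu>))"
proof (rule balanced_if_switched_positive[where \<nu> = \<nu>])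
  show "outer_edges (delete_edges (induced G X) (delta G X \<nu>)) = {}"
    by (auto simp: outer_edges_def delete_edges_def elim!: ends_induced_edge)
  show "\<nu> v = 1 \<or> \<nu> v = -1" if "v \<in> verts (delete_edges (induced G X) (delta G X \<nu>))" for v
    using that assms by (auto simp: switching_on_def delete_edges_def)
  show "esign (switch (delete_edges (induced G X) (delta G X \<nu>)) \<nu>) e = 1"
    if "e \<in> edges (delete_edges (induced G X) (delta G X \<nu>))" for e
    using switched_positive_outside_delta[OF assms(1), of e] that
    by (simp add: delete_edges_def switch_def induced_def)
qed

text \<open>
  If \<open>X\<close> is a proper subset, connectedness of \<open>G\<close> yields a boundary link.  If \<open>X\<close> contains every
  vertex, an empty set would leave no outer-edges and make all edges positive after switching.
\<close>

lemma delta_nonempty: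
  assumes "graph_connected G" "\<not> balanced G" "X \<noteq> {}" "X \<subseteq> verts G" "switching_on G X \<nu>"
  shows "delta G X \<nu> \<noteq> {}"
proof
  assume empty: "delta G X \<nu> = {}"
  show False
  proof (cases "X = verts G")
    case True
    have out: "outer_edges G = {}"
      using empty ends_in_verts True
      by (auto simp: delta_def outer_edges_at_def outer_edges_def)
    have "balanced G"
      using out assms(5) switched_positive_outside_delta[OF assms(5)] empty
        edges_subset_induced_verts[OF out] True
      by (intro balanced_if_switched_positive[where \<nu> = \<nu>]) (auto simp: switching_on_def)
    with assms(2) show False by blast
  next
    case False
    then obtain u w where "u \<in> X" "w \<notin> X" "(u, w) \<in> (adj_rel G)\<^sup>*"
      using assms(1,3,4) unfolding graph_connected_def by blast
    from this(3,1,2) obtain a b where "(a, b) \<in> adj_rel G" "a \<in> X" "b \<notin> X"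
      by (rule rtrancl_leaves_set)
    then obtain e where e: "e \<in> edges G" "ends G e = {#a, b#}" "a \<in> X" "b \<notin> X"
      by (auto simp: adj_rel_def)
    then have "a \<noteq> b" "b \<in> verts G" using ends_in_verts[OF e(1)] by auto
    with e have "e \<in> boundary_links G X" unfolding boundary_links_def links_def by blast
    with empty show False by (simp add: delta_def)
  qed
qed

text \<open>
  The switching is one with as few negative edges in the induced subgraph as possible; a disconnected
  positive part would allow an improvement by \<open>separating_switching\<close>.
\<close>

lemma switching_with_connected_positive_part:
  assumes "X \<subseteq> verts G" "graph_connected (induced G X)"
  obtains \<nu> where "switching_on G X \<nu>"
    and "graph_connected (delete_edges (induced G X) (delta G X \<nu>))"
proof -
  let ?H = "induced G X"
  define neg where "neg \<nu> = {e \<in> edges ?H. esign (switch G \<nu>) e = -1}" for \<nu>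
  have "switching_on G X (\<lambda>_. 1)" by (simp add: switching_on_def)
  then obtain \<nu> where \<nu>: "switching_on G X \<nu>"
    and least: "\<And>\<mu>. switching_on G X \<mu> \<Longrightarrow> card (neg \<nu>) \<le> card (neg \<mu>)"
    using ex_has_least_nat[of "switching_on G X" _ "\<lambda>\<nu>. card (neg \<nu>)"] by blast
  have "graph_connected (delete_edges ?H (delta G X \<nu>))"
  proof (rule ccontr)
    assume dis: "\<not> ?thesis"
    from separating_switching[OF assms(2) dis two_ends_induced]
    obtain \<kappa> :: "'v \<Rightarrow> int" and e where \<kappa>: "\<And>v. \<kappa> v = 1 \<or> \<kappa> v = -1"
      and pos: "\<And>f. f \<in> edges ?H - delta G X \<nu> \<Longrightarrow> (\<Prod>v\<in>#ends G f. \<kappa> v) = 1"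
      and e: "e \<in> edges ?H \<inter> delta G X \<nu>" "(\<Prod>v\<in>#ends G e. \<kappa> v) = -1"
      by auto
    \<comment> \<open>The factor \<open>\<kappa>\<close> is cut off outside \<open>X\<close> so that \<open>\<mu>\<close> is again a switching on \<open>X\<close>.\<close>
    define \<mu> where "\<mu> v = (if v \<in> X then \<nu> v * \<kappa> v else 1)" for v
    have \<mu>: "switching_on G X \<mu>"
      unfolding switching_on_def
    proof (intro conjI ballI)
      show "\<mu> v = 1 \<or> \<mu> v = -1" if "v \<in> verts G" for v
        using \<kappa>[of v] \<nu> that by (auto simp: switching_on_def \<mu>_def)
    qed (simp add: \<mu>_def)
    have sign: "esign (switch G \<mu>) f = esign (switch G \<nu>) f * (\<Prod>v\<in>#ends G f. \<kappa> v)"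
      if "f \<in> edges ?H" for f
      using that by (auto elim!: ends_induced_edge simp: esign_switch \<mu>_def)
    have neg: "neg \<nu> = edges ?H \<inter> delta G X \<nu>"
      by (simp add: neg_def delta_inter_induced)
    have "neg \<mu> \<subseteq> neg \<nu>"
    proof
      fix f assume f: "f \<in> neg \<mu>"
      show "f \<in> neg \<nu>"
      proof (rule ccontr)
        assume "f \<notin> neg \<nu>"
        with f neg have "f \<in> edges ?H - delta G X \<nu>" by (auto simp: neg_def)
        with pos[of f] sign[of f] switched_positive_outside_delta[OF \<nu>, of f] f
        show False by (auto simp: neg_def)
      qed
    qed
    moreover have "e \<in> neg \<nu>" using e neg by simp
    moreover have "e \<notin> neg \<mu>"
      using sign[of e] e delta_inter_induced[of X \<nu>] by (auto simp: neg_def)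
    ultimately have "neg \<mu> \<subset> neg \<nu>" by blast
    moreover have "finite (neg \<nu>)"
      using finite_edges edges_induced_subset[of G X] by (auto simp: neg_def intro: finite_subset)
    ultimately have "card (neg \<mu>) < card (neg \<nu>)" by (simp add: psubset_card_mono)
    with least[OF \<mu>] show False by simp
  qed
  with \<nu> show ?thesis by (rule that)
qed

lemma uni_cut_by_if_connected:
  assumes "graph_connected G" "\<not> balanced G" "X \<noteq> {}" "X \<subseteq> verts G"
    and "graph_connected (induced G X)" and \<nu>: "switching_on G X \<nu>"
    and conn: "graph_connected (delete_edges (induced G X) (delta G X \<nu>))"
  shows "uni_cut_by G X \<nu> (delta G X \<nu>)"
proof -
  let ?H = "induced G X"
  have "\<not> balanced (add_edge (delete_edges ?H (delta G X \<nu>)) e)"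
    if e: "e \<in> edges ?H \<inter> delta G X \<nu>" for e
  proof -
    obtain p q where "ends G e = {#p, q#}" using e by (auto elim: ends_induced_edge)
    then show ?thesis
      using e \<nu> assms(4) switched_positive_outside_delta[OF \<nu>] delta_inter_induced[of X \<nu>]
      by (intro negative_edge_unbalances[OF signed_graph_induced[OF assms(4)] conn, of \<nu> e p q])
        (auto simp: switching_on_def)
  qed
  then show ?thesis
    unfolding uni_cut_by_def cut_by_def
    using assms delta_nonempty[OF assms(1-4) \<nu>] balanced_outside_delta[OF \<nu> assms(4)]
      switched_positive_outside_delta[OF \<nu>] delta_inter_induced[of X \<nu>]
    by blast
qed

text \<open>
  The product \<open>\<nu> v * \<mu> v\<close> is invariant along the edges of \<open>G[X]\<close>, because both switchings give each of
  them the same sign; its constant value on \<open>X\<close> is the sign by which they differ.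
\<close>

lemma switching_unique_up_to_sign:
  assumes "X \<subseteq> verts G" "graph_connected (induced G X)"
    and \<nu>: "switching_on G X \<nu>" and \<mu>: "switching_on G X \<mu>"
    and eq: "delta G X \<nu> = delta G X \<mu>"
  shows "(\<forall>v\<in>X. \<mu> v = \<nu> v) \<or> (\<forall>v\<in>X. \<mu> v = - \<nu> v)"
proof -
  let ?H = "induced G X"
  have val: "\<nu> v = 1 \<or> \<nu> v = -1" "\<mu> v = 1 \<or> \<mu> v = -1" if "v \<in> X" for v
    using \<nu> \<mu> assms(1) that by (auto simp: switching_on_def)
  have sign: "esign (switch G \<nu>) e = esign (switch G \<mu>) e" if "e \<in> edges ?H" for e
  proof (cases "e \<in> delta G X \<nu>")
    case True
    then have "esign (switch G \<nu>) e = -1" "esign (switch G \<mu>) e = -1"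
      using that eq delta_inter_induced[of X \<nu>] delta_inter_induced[of X \<mu>] by blast+
    then show ?thesis by simp
  next
    case False
    with that eq show ?thesis
      using switched_positive_outside_delta[OF \<nu>] switched_positive_outside_delta[OF \<mu>] by simp
  qed
  have adj: "\<nu> p * \<mu> p = \<nu> q * \<mu> q" if pq: "(p, q) \<in> adj_rel ?H" for p q
  proof -
    obtain e where e: "e \<in> edges ?H" "ends G e = {#p, q#}" using pq by (auto simp: adj_rel_def)
    then have X: "p \<in> X" "q \<in> X" by (auto elim!: ends_induced_edge simp: add_eq_conv_ex)
    have "esign G e = 1 \<or> esign G e = -1"
      using esign_values e edges_induced_subset[of G X] by blast
    then have "\<nu> p * \<nu> q = \<mu> p * \<mu> q"
      using sign[OF e(1)] by (auto simp: esign_switch e)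
    with val[OF X(1)] val[OF X(2)] show ?thesis by auto
  qed
  have const: "\<nu> p * \<mu> p = \<nu> q * \<mu> q" if "p \<in> X" "q \<in> X" for p q
  proof -
    have "(p, q) \<in> (adj_rel ?H)\<^sup>*" using assms(2) that by (simp add: graph_connected_def)
    then show ?thesis by (induction rule: rtrancl_induct) (auto dest: adj)
  qed
  obtain x where x: "x \<in> X" using assms(2) by (auto simp: graph_connected_def)
  have "\<nu> x * \<mu> x = 1 \<or> \<nu> x * \<mu> x = -1" using val[OF x] by auto
  then show ?thesis
  proof
    assume 1: "\<nu> x * \<mu> x = 1"
    have "\<mu> v = \<nu> v" if v: "v \<in> X" for v
      using const[OF v x] val[OF v] 1 by auto
    then show ?thesis by blast
  next
    assume 1: "\<nu> x * \<mu> x = -1"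
    have "\<mu> v = - \<nu> v" if v: "v \<in> X" for v
      using const[OF v x] val[OF v] 1 by auto
    then show ?thesis by blast
  qed
qed

end

theorem theorem4p2:
  fixes \<Sigma> :: "('v, 'e) sgraph" and X :: "'v set"
  assumes "signed_graph \<Sigma>"
    and "graph_connected \<Sigma>"
    and "\<not> balanced \<Sigma>"
    and "X \<noteq> {}" and "X \<subseteq> verts \<Sigma>"
    and "graph_connected (induced \<Sigma> X)"
  shows "(\<exists>\<nu>. switching_on \<Sigma> X \<nu> \<and> uni_cut_by \<Sigma> X \<nu> (delta \<Sigma> X \<nu>)) \<and>
    (\<forall>\<nu>. switching_on \<Sigma> X \<nu> \<and> uni_cut_by \<Sigma> X \<nu> (delta \<Sigma> X \<nu>) \<longrightarrow>
       graph_connected (delete_edges (induced \<Sigma> X) (delta \<Sigma> X \<nu>)) \<and>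
       (\<forall>\<mu>. switching_on \<Sigma> X \<mu> \<and> delta \<Sigma> X \<nu> = delta \<Sigma> X \<mu> \<longrightarrow>
          (\<forall>v \<in> X. \<mu> v = \<nu> v) \<or> (\<forall>v \<in> X. \<mu> v = - \<nu> v)))"
proof -
  interpret signed_graph \<Sigma> by fact
  have "\<exists>\<nu>. switching_on \<Sigma> X \<nu> \<and> uni_cut_by \<Sigma> X \<nu> (delta \<Sigma> X \<nu>)"
    using switching_with_connected_positive_part[OF assms(5,6)] uni_cut_by_if_connected[OF assms(2-6)]
    by metis
  moreover have "graph_connected (delete_edges (induced \<Sigma> X) (delta \<Sigma> X \<nu>))"
    if "uni_cut_by \<Sigma> X \<nu> (delta \<Sigma> X \<nu>)" for \<nu>
    using that by (intro connected_if_edges_unbalance[OF assms(6) two_ends_induced])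
      (simp_all add: uni_cut_by_def cut_by_def)
  moreover note switching_unique_up_to_sign[OF assms(5,6)]
  ultimately show ?thesis by blast
qed

end
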